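(* Let $\Bbbk$ be a field. Let $\mathbf{BHNS}$ be the category of BiHom-NS-algebras over $\Bbbk$ and $\mathbf{TRB}$ the category of twisted Rota-Baxter operators over $\Bbbk$. The functors $F:\mathbf{BHNS}\to\mathbf{TRB}$ and $G:\mathbf{TRB}\to\mathbf{BHNS}$ described in the context form an adjoint pair, with $F$ left adjoint to $G$: for every BiHom-NS-algebra $A$ and every object $(\pi,H)$ of $\mathbf{TRB}$ there is a natural bijection $$\mathrm{Hom}_{\mathbf{TRB}}(F(A),(\pi,H))\cong\mathrm{Hom}_{\mathbf{BHNS}}(A,G(\pi,H)).$$
   Context: Everything is over a field $\Bbbk$; all maps are linear; algebras are not assumed associative or unital. A BiHom-associative algebra $(A,\mu,\alpha,\beta)$ is a linear space $A$ with linear maps $\mu:A\otimes A\to A$, $\mu(x\otimes y)=xy$, and $\alpha,\beta:A\to A$ such that $\alpha\circ\beta=\beta\circ\alpha$, $\alpha(xy)=\alpha(x)\alpha(y)$, $\beta(xy)=\beta(x)\beta(y)$ and $\alpha(x)(yz)=(xy)\beta(z)$ for all $x,y,z\in A$. A morphism of BiHom-associative algebras is a linear map preserving the multiplication and commuting with the structure maps $\alpha$ and $\beta$. An $A$-bimodule $(M,l,r,\alpha_M,\beta_M)$ over a BiHom-associative algebra $(A,\mu_A,\alpha_A,\beta_A)$ is a linear space $M$ with commuting linear maps $\alpha_M,\beta_M:M\to M$ and linear maps $l:A\otimes M\to M$, $x\otimes m\mapsto x\cdot m$, and $r:M\otimes A\to M$, $m\otimes x\mapsto m\cdot x$, such that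 for all $x,x'\in A$, $m\in M$: $\alpha_M(x\cdot m)=\alpha_A(x)\cdot\alpha_M(m)$, $\beta_M(x\cdot m)=\beta_A(x)\cdot\beta_M(m)$, $\alpha_M(m\cdot x)=\alpha_M(m)\cdot\alpha_A(x)$, $\beta_M(m\cdot x)=\beta_M(m)\cdot\beta_A(x)$, $\alpha_A(x)\cdot(x'\cdot m)=(xx')\cdot\beta_M(m)$, $\alpha_M(m)\cdot(xx')=(m\cdot x)\cdot\beta_A(x')$, and $\alpha_A(x)\cdot(m\cdot x')=(x\cdot m)\cdot\beta_A(x')$. A Hochschild 2-cocycle on $A$ with values in $M$ is a linear map $H:A\otimes A\to M$ with $H\circ(\alpha_A\otimes\alpha_A)=\alpha_M\circ H$, $H\circ(\beta_A\otimes\beta_A)=\beta_M\circ H$ and $\alpha_A(x)\cdot H(y,z)-H(xy,\beta_A(z))+H(\alpha_A(x),yz)-H(x,y)\cdot\beta_A(z)=0$ for all $x,y,z\in A$. An $H$-twisted Rota-Baxter operator is a linear map $\pi:M\to A$ with $\pi\circ\alpha_M=\alpha_A\circ\pi$, $\pi\circ\beta_M=\beta_A\circ\pi$ and $\pi(m)\pi(n)=\pi\big(\pi(m)\cdot n+m\cdot\pi(n)+H(\pi(m),\pi(n))\big)$ for all $m,n\in M$. A BiHom-NS-algebra $(A,\prec,\succ,\vee,\alpha,\beta)$ is a linear space $A$ with linear maps $\prec,\succ,\vee:A\otimes A\to A$ and $\alpha,\beta:A\to A$ such that $\alpha\circ\beta=\beta\circ\alpha$, both $\alpha$ and $\beta$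 are multiplicative with respect to each of $\prec,\succ,\vee$, and, writing $x\ast y=x\prec y+x\succ y+x\vee y$, for all $x,y,z\in A$: $(x\prec y)\prec\beta(z)=\alpha(x)\prec(y\ast z)$; $(x\succ y)\prec\beta(z)=\alpha(x)\succ(y\prec z)$; $(x\ast y)\succ\beta(z)=\alpha(x)\succ(y\succ z)$; $(x\vee y)\prec\beta(z)+(x\ast y)\vee\beta(z)=\alpha(x)\succ(y\vee z)+\alpha(x)\vee(y\ast z)$. Category $\mathbf{BHNS}$: objects are BiHom-NS-algebras; morphisms are linear maps preserving $\prec,\succ,\vee$ and commuting with the structure maps $\alpha,\beta$. Category $\mathbf{TRB}$: an object, written $(\pi,H)$, consists of a BiHom-associative algebra $A$, an $A$-bimodule $M$, a Hochschild 2-cocycle $H:A\otimes A\to M$ and an $H$-twisted Rota-Baxter operator $\pi:M\to A$. A morphism from $(\pi:M\to A,\,H)$ to $(\theta:M'\to A',\,H')$ is a pair $(\varphi,\psi)$ where $\varphi:A\to A'$ is a morphism of BiHom-associative algebras and $\psi:M\to M'$ is a linear map with $\psi\circ\alpha_M=\alpha_{M'}\circ\psi$, $\psi\circ\beta_M=\beta_{M'}\circ\psi$, $\psi(x\cdot m)=\varphi(x)\cdot\psi(m)$ and $\psi(m\cdot x)=\psi(m)\cdot\varphi(x)$ for all $x\in A$, $m\in M$, such that $\psi\circ H=H'\circ(\varphi\otimes\varphi)$ and $\varphi\circ\pi=\theta\circ\psi$. Functor $G$: it sends $(\pi:M\to A,\,H)$ to the BiHom-NS-algebra $(M,\prec,\succ,\vee,\alpha_M,\beta_M)$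 with $m\prec n=m\cdot\pi(n)$, $m\succ n=\pi(m)\cdot n$, $m\vee n=H(\pi(m),\pi(n))$, and a morphism $(\varphi,\psi)$ to $\psi$. Functor $F$: for a BiHom-NS-algebra $(A,\prec,\succ,\vee,\alpha,\beta)$ put $A_{bhas}=(A,\ast,\alpha,\beta)$ with $\ast=\prec+\succ+\vee$; this is a BiHom-associative algebra, $A$ is an $A_{bhas}$-bimodule with left action $x\cdot m=x\succ m$, right action $m\cdot x=m\prec x$ and structure maps $\alpha,\beta$, and $H(x,y)=x\vee y$ is a Hochschild 2-cocycle on $A_{bhas}$ with values in this bimodule. $F$ sends $A$ to the $H$-twisted Rota-Baxter operator $id_A:(A,\succ,\prec,\alpha,\beta)\to A_{bhas}$ and a morphism $f$ to $(f,f)$. *)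

theory Defs
  imports "HOL-Algebra.Module" "HOL-Library.FuncSet"
begin

section \<open>Categories, functors and adjunctions\<close>

text \<open>
  Hom-sets are indexed by objects and need not be disjoint, so identities and composition take the
  objects involved as arguments: for \<open>f \<in> Hom C X Y\<close> and \<open>g \<in> Hom C Y Z\<close>,
  \<open>Comp C X Y Z g f\<close> is the composite \<open>g \<circ> f\<close>.
\<close>

record ('o, 'm) category =
  Ob :: "'o set"
  Hom :: "'o \<Rightarrow> 'o \<Rightarrow> 'm set"
  Id :: "'o \<Rightarrow> 'm"
  Comp :: "'o \<Rightarrow> 'o \<Rightarrow> 'o \<Rightarrow> 'm \<Rightarrow> 'm \<Rightarrow> 'm"

locale category =
  fixes C :: "('o, 'm) category"
  assumes Id_Hom: "X \<in> Ob C \<Longrightarrow> Id C X \<in> Hom C X X"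
    and Comp_Hom: "\<lbrakk>X \<in> Ob C; Y \<in> Ob C; Z \<in> Ob C; f \<in> Hom C X Y; g \<in> Hom C Y Z\<rbrakk>
      \<Longrightarrow> Comp C X Y Z g f \<in> Hom C X Z"
    and Comp_Id_right: "\<lbrakk>X \<in> Ob C; Y \<in> Ob C; f \<in> Hom C X Y\<rbrakk> \<Longrightarrow> Comp C X X Y f (Id C X) = f"
    and Comp_Id_left: "\<lbrakk>X \<in> Ob C; Y \<in> Ob C; f \<in> Hom C X Y\<rbrakk> \<Longrightarrow> Comp C X Y Y (Id C Y) f = f"
    and Comp_assoc: "\<lbrakk>W \<in> Ob C; X \<in> Ob C; Y \<in> Ob C; Z \<in> Ob C;
        f \<in> Hom C W X; g \<in> Hom C X Y; h \<in> Hom C Y Z\<rbrakk>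
      \<Longrightarrow> Comp C W X Z (Comp C X Y Z h g) f = Comp C W Y Z h (Comp C W X Y g f)"

record ('o, 'm, 'p, 'n) cat_functor =
  on_Ob :: "'o \<Rightarrow> 'p"
  on_Hom :: "'o \<Rightarrow> 'o \<Rightarrow> 'm \<Rightarrow> 'n"

locale cat_functor = source: category C + target: category D
  for C :: "('o, 'm) category" and D :: "('p, 'n) category" +
  fixes F :: "('o, 'm, 'p, 'n) cat_functor"
  assumes on_Ob_Ob: "X \<in> Ob C \<Longrightarrow> on_Ob F X \<in> Ob D"
    and on_Hom_Hom: "\<lbrakk>X \<in> Ob C; Y \<in> Ob C; f \<in> Hom C X Y\<rbrakk>
      \<Longrightarrow> on_Hom F X Y f \<in> Hom D (on_Ob F X) (on_Ob F Y)"
    and on_Hom_Id: "X \<in> Ob C \<Longrightarrow> on_Hom F X X (Id C X) = Id D (on_Ob F X)"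
    and on_Hom_Comp: "\<lbrakk>X \<in> Ob C; Y \<in> Ob C; Z \<in> Ob C; f \<in> Hom C X Y; g \<in> Hom C Y Z\<rbrakk>
      \<Longrightarrow> on_Hom F X Z (Comp C X Y Z g f) =
          Comp D (on_Ob F X) (on_Ob F Y) (on_Ob F Z) (on_Hom F Y Z g) (on_Hom F X Y f)"

text \<open>
  The naturality condition reads \<open>\<Phi> (k \<circ> h \<circ> F f) = G k \<circ> \<Phi> h \<circ> f\<close>
  for \<open>f : A' \<rightarrow> A\<close>, \<open>h : F A \<rightarrow> X\<close> and \<open>k : X \<rightarrow> X'\<close>.
\<close>

locale hom_adjunction = left: cat_functor C D F + right: cat_functor D C G
  for C :: "('o, 'm) category" and D :: "('p, 'n) category"
    and F :: "('o, 'm, 'p, 'n) cat_functor" and G :: "('p, 'n, 'o, 'm) cat_functor" +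
  fixes \<Phi> :: "'o \<Rightarrow> 'p \<Rightarrow> 'n \<Rightarrow> 'm"
  assumes bij: "\<lbrakk>A \<in> Ob C; X \<in> Ob D\<rbrakk>
      \<Longrightarrow> bij_betw (\<Phi> A X) (Hom D (on_Ob F A) X) (Hom C A (on_Ob G X))"
    and natural: "\<lbrakk>A \<in> Ob C; A' \<in> Ob C; X \<in> Ob D; X' \<in> Ob D;
        f \<in> Hom C A' A; h \<in> Hom D (on_Ob F A) X; k \<in> Hom D X X'\<rbrakk>
      \<Longrightarrow> \<Phi> A' X' (Comp D (on_Ob F A') X X' k
                   (Comp D (on_Ob F A') (on_Ob F A) X h (on_Hom F A' A f)))
        = Comp C A' (on_Ob G X) (on_Ob G X') (on_Hom G X X' k)
            (Comp C A' A (on_Ob G X) (\<Phi> A X h) f)"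

definition left_adjoint ::
  "('o, 'm) category \<Rightarrow> ('p, 'n) category
    \<Rightarrow> ('o, 'm, 'p, 'n) cat_functor \<Rightarrow> ('p, 'n, 'o, 'm) cat_functor \<Rightarrow> bool"
  where "left_adjoint C D F G \<longleftrightarrow> (\<exists>\<Phi>. hom_adjunction C D F G \<Phi>)"


section \<open>Linear and bilinear maps\<close>

text \<open>
  When \<open>K\<close> is a field, \<open>module K V\<close> says that \<open>V\<close> is a vector space over \<open>K\<close>.
  Linear maps \<open>U \<otimes> V \<rightarrow> W\<close> are represented by bilinear maps, curried.
\<close>

definition linear_maps ::
  "('k, 'x) ring_scheme \<Rightarrow> ('k, 'a, 'y) module_scheme \<Rightarrow> ('k, 'b, 'z) module_scheme \<Rightarrow> ('a \<Rightarrow> 'b) set"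
  where "linear_maps K V W = {f \<in> carrier V \<rightarrow> carrier W.
    (\<forall>x\<in>carrier V. \<forall>y\<in>carrier V. f (x \<oplus>\<^bsub>V\<^esub> y) = f x \<oplus>\<^bsub>W\<^esub> f y) \<and>
    (\<forall>c\<in>carrier K. \<forall>x\<in>carrier V. f (c \<odot>\<^bsub>V\<^esub> x) = c \<odot>\<^bsub>W\<^esub> f x)}"

definition bilinear_maps ::
  "('k, 'x) ring_scheme \<Rightarrow> ('k, 'a, 'u) module_scheme \<Rightarrow> ('k, 'b, 'v) module_scheme
    \<Rightarrow> ('k, 'c, 'w) module_scheme \<Rightarrow> ('a \<Rightarrow> 'b \<Rightarrow> 'c) set"
  where "bilinear_maps K U V W = {f.
    (\<forall>x\<in>carrier U. (\<lambda>y. f x y) \<in> linear_maps K V W) \<and>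
    (\<forall>y\<in>carrier V. (\<lambda>x. f x y) \<in> linear_maps K U W)}"


section \<open>BiHom-associative algebras and bimodules\<close>

text \<open>
  The inherited field \<open>mult\<close> serves as the product \<open>\<mu>\<close> of a BiHom-associative algebra.
  The inherited field \<open>one\<close> is never constrained or used, and neither is \<open>mult\<close> in
  a bimodule or in a BiHom-NS-algebra. Morphisms ignore these unused fields.
\<close>

record ('k, 'a) bihom = "('k, 'a) module" +
  alpha :: "'a \<Rightarrow> 'a"
  beta :: "'a \<Rightarrow> 'a"

locale bihom_space = module K V for K (structure) and V (structure) +
  assumes alpha_linear: "alpha V \<in> linear_maps K V V"
    and beta_linear: "beta V \<in> linear_maps K V V"
    and alpha_beta: "x \<in> carrier V \<Longrightarrow> alpha V (beta V x) = beta V (alpha V x)"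

locale bihom_assoc_algebra = bihom_space K A for K (structure) and A (structure) +
  assumes mult_bilinear: "mult A \<in> bilinear_maps K A A A"
    and alpha_mult: "\<lbrakk>x \<in> carrier A; y \<in> carrier A\<rbrakk>
      \<Longrightarrow> alpha A (x \<otimes>\<^bsub>A\<^esub> y) = alpha A x \<otimes>\<^bsub>A\<^esub> alpha A y"
    and beta_mult: "\<lbrakk>x \<in> carrier A; y \<in> carrier A\<rbrakk>
      \<Longrightarrow> beta A (x \<otimes>\<^bsub>A\<^esub> y) = beta A x \<otimes>\<^bsub>A\<^esub> beta A y"
    and bihom_assoc: "\<lbrakk>x \<in> carrier A; y \<in> carrier A; z \<in> carrier A\<rbrakk>
      \<Longrightarrow> alpha A x \<otimes>\<^bsub>A\<^esub> (y \<otimes>\<^bsub>A\<^esub> z) = (x \<otimes>\<^bsub>A\<^esub> y) \<otimes>\<^bsub>A\<^esub> beta A z"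

text \<open>\<open>l x m\<close> is \<open>x \<cdot> m\<close> and \<open>r m x\<close> is \<open>m \<cdot> x\<close>.\<close>

locale bihom_bimodule = algebra: bihom_assoc_algebra K A + space: bihom_space K M
  for K (structure) and A (structure) and M (structure) +
  fixes l :: "'c \<Rightarrow> 'e \<Rightarrow> 'e" and r :: "'e \<Rightarrow> 'c \<Rightarrow> 'e"
  assumes l_bilinear: "l \<in> bilinear_maps K A M M"
    and r_bilinear: "r \<in> bilinear_maps K M A M"
    and alpha_l: "\<lbrakk>x \<in> carrier A; m \<in> carrier M\<rbrakk> \<Longrightarrow> alpha M (l x m) = l (alpha A x) (alpha M m)"
    and beta_l: "\<lbrakk>x \<in> carrier A; m \<in> carrier M\<rbrakk> \<Longrightarrow> beta M (l x m) = l (beta A x) (beta M m)"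
    and alpha_r: "\<lbrakk>x \<in> carrier A; m \<in> carrier M\<rbrakk> \<Longrightarrow> alpha M (r m x) = r (alpha M m) (alpha A x)"
    and beta_r: "\<lbrakk>x \<in> carrier A; m \<in> carrier M\<rbrakk> \<Longrightarrow> beta M (r m x) = r (beta M m) (beta A x)"
    and l_l: "\<lbrakk>x \<in> carrier A; x' \<in> carrier A; m \<in> carrier M\<rbrakk>
      \<Longrightarrow> l (alpha A x) (l x' m) = l (x \<otimes>\<^bsub>A\<^esub> x') (beta M m)"
    and r_r: "\<lbrakk>x \<in> carrier A; x' \<in> carrier A; m \<in> carrier M\<rbrakk>
      \<Longrightarrow> r (alpha M m) (x \<otimes>\<^bsub>A\<^esub> x') = r (r m x) (beta A x')"
    and l_r: "\<lbrakk>x \<in> carrier A; x' \<in> carrier A; m \<in> carrier M\<rbrakk>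
      \<Longrightarrow> l (alpha A x) (r m x') = r (l x m) (beta A x')"

locale hochschild_2_cocycle = bihom_bimodule K A M l r
  for K (structure) and A (structure) and M (structure) and l r +
  fixes H :: "'c \<Rightarrow> 'c \<Rightarrow> 'e"
  assumes H_bilinear: "H \<in> bilinear_maps K A A M"
    and H_alpha: "\<lbrakk>x \<in> carrier A; y \<in> carrier A\<rbrakk> \<Longrightarrow> H (alpha A x) (alpha A y) = alpha M (H x y)"
    and H_beta: "\<lbrakk>x \<in> carrier A; y \<in> carrier A\<rbrakk> \<Longrightarrow> H (beta A x) (beta A y) = beta M (H x y)"
    and cocycle: "\<lbrakk>x \<in> carrier A; y \<in> carrier A; z \<in> carrier A\<rbrakk>
      \<Longrightarrow> l (alpha A x) (H y z) \<ominus>\<^bsub>M\<^esub> H (x \<otimes>\<^bsub>A\<^esub> y) (beta A z)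
            \<oplus>\<^bsub>M\<^esub> H (alpha A x) (y \<otimes>\<^bsub>A\<^esub> z) \<ominus>\<^bsub>M\<^esub> r (H x y) (beta A z) = \<zero>\<^bsub>M\<^esub>"

locale twisted_rota_baxter = hochschild_2_cocycle K A M l r H
  for K (structure) and A (structure) and M (structure) and l r H +
  fixes p :: "'e \<Rightarrow> 'c"
  assumes p_linear: "p \<in> linear_maps K M A"
    and p_alpha: "m \<in> carrier M \<Longrightarrow> p (alpha M m) = alpha A (p m)"
    and p_beta: "m \<in> carrier M \<Longrightarrow> p (beta M m) = beta A (p m)"
    and rota_baxter: "\<lbrakk>m \<in> carrier M; n \<in> carrier M\<rbrakk>
      \<Longrightarrow> p m \<otimes>\<^bsub>A\<^esub> p n = p (l (p m) n \<oplus>\<^bsub>M\<^esub> r m (p n) \<oplus>\<^bsub>M\<^esub> H (p m) (p n))"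


section \<open>BiHom-NS-algebras\<close>

record ('k, 'a) bihom_ns = "('k, 'a) bihom" +
  prec :: "'a \<Rightarrow> 'a \<Rightarrow> 'a" (infixl \<open>\<prec>\<index>\<close> 70)
  succ :: "'a \<Rightarrow> 'a \<Rightarrow> 'a" (infixl \<open>\<succ>\<index>\<close> 70)
  vee :: "'a \<Rightarrow> 'a \<Rightarrow> 'a" (infixl \<open>\<diamondop>\<index>\<close> 70)

definition ns_star :: "('k, 'a, 'z) bihom_ns_scheme \<Rightarrow> 'a \<Rightarrow> 'a \<Rightarrow> 'a" (infixl \<open>\<star>\<index>\<close> 70)
  where "x \<star>\<^bsub>A\<^esub> y = (x \<prec>\<^bsub>A\<^esub> y) \<oplus>\<^bsub>A\<^esub> (x \<succ>\<^bsub>A\<^esub> y) \<oplus>\<^bsub>A\<^esub> (x \<diamondop>\<^bsub>A\<^esub> y)"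

locale bihom_ns_algebra = bihom_space K A for K (structure) and A (structure) +
  assumes prec_bilinear: "prec A \<in> bilinear_maps K A A A"
    and succ_bilinear: "succ A \<in> bilinear_maps K A A A"
    and vee_bilinear: "vee A \<in> bilinear_maps K A A A"
    and alpha_prec: "\<lbrakk>x \<in> carrier A; y \<in> carrier A\<rbrakk>
      \<Longrightarrow> alpha A (x \<prec>\<^bsub>A\<^esub> y) = alpha A x \<prec>\<^bsub>A\<^esub> alpha A y"
    and alpha_succ: "\<lbrakk>x \<in> carrier A; y \<in> carrier A\<rbrakk>
      \<Longrightarrow> alpha A (x \<succ>\<^bsub>A\<^esub> y) = alpha A x \<succ>\<^bsub>A\<^esub> alpha A y"
    and alpha_vee: "\<lbrakk>x \<in> carrier A; y \<in> carrier A\<rbrakk>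
      \<Longrightarrow> alpha A (x \<diamondop>\<^bsub>A\<^esub> y) = alpha A x \<diamondop>\<^bsub>A\<^esub> alpha A y"
    and beta_prec: "\<lbrakk>x \<in> carrier A; y \<in> carrier A\<rbrakk>
      \<Longrightarrow> beta A (x \<prec>\<^bsub>A\<^esub> y) = beta A x \<prec>\<^bsub>A\<^esub> beta A y"
    and beta_succ: "\<lbrakk>x \<in> carrier A; y \<in> carrier A\<rbrakk>
      \<Longrightarrow> beta A (x \<succ>\<^bsub>A\<^esub> y) = beta A x \<succ>\<^bsub>A\<^esub> beta A y"
    and beta_vee: "\<lbrakk>x \<in> carrier A; y \<in> carrier A\<rbrakk>
      \<Longrightarrow> beta A (x \<diamondop>\<^bsub>A\<^esub> y) = beta A x \<diamondop>\<^bsub>A\<^esub> beta A y"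
    and prec_prec: "\<lbrakk>x \<in> carrier A; y \<in> carrier A; z \<in> carrier A\<rbrakk>
      \<Longrightarrow> (x \<prec>\<^bsub>A\<^esub> y) \<prec>\<^bsub>A\<^esub> beta A z = alpha A x \<prec>\<^bsub>A\<^esub> (y \<star>\<^bsub>A\<^esub> z)"
    and succ_prec: "\<lbrakk>x \<in> carrier A; y \<in> carrier A; z \<in> carrier A\<rbrakk>
      \<Longrightarrow> (x \<succ>\<^bsub>A\<^esub> y) \<prec>\<^bsub>A\<^esub> beta A z = alpha A x \<succ>\<^bsub>A\<^esub> (y \<prec>\<^bsub>A\<^esub> z)"
    and star_succ: "\<lbrakk>x \<in> carrier A; y \<in> carrier A; z \<in> carrier A\<rbrakk>
      \<Longrightarrow> (x \<star>\<^bsub>A\<^esub> y) \<succ>\<^bsub>A\<^esub> beta A z = alpha A x \<succ>\<^bsub>A\<^esub> (y \<succ>\<^bsub>A\<^esub> z)"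
    and vee_prec: "\<lbrakk>x \<in> carrier A; y \<in> carrier A; z \<in> carrier A\<rbrakk>
      \<Longrightarrow> ((x \<diamondop>\<^bsub>A\<^esub> y) \<prec>\<^bsub>A\<^esub> beta A z) \<oplus>\<^bsub>A\<^esub> ((x \<star>\<^bsub>A\<^esub> y) \<diamondop>\<^bsub>A\<^esub> beta A z)
        = (alpha A x \<succ>\<^bsub>A\<^esub> (y \<diamondop>\<^bsub>A\<^esub> z)) \<oplus>\<^bsub>A\<^esub> (alpha A x \<diamondop>\<^bsub>A\<^esub> (y \<star>\<^bsub>A\<^esub> z))"


section \<open>The two categories\<close>

text \<open>
  Morphisms are extensional functions (with value \<open>undefined\<close> off the carrier of the source),
  so that equality of morphisms is equality of functions on the carrier.
\<close>

definition bihom_linear_maps ::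
  "('k, 'x) ring_scheme \<Rightarrow> ('k, 'a, 'y) bihom_scheme \<Rightarrow> ('k, 'b, 'z) bihom_scheme \<Rightarrow> ('a \<Rightarrow> 'b) set"
  where "bihom_linear_maps K V W = {f \<in> linear_maps K V W.
    f \<in> extensional (carrier V) \<and>
    (\<forall>x\<in>carrier V. f (alpha V x) = alpha W (f x)) \<and>
    (\<forall>x\<in>carrier V. f (beta V x) = beta W (f x))}"

definition bihom_assoc_homs ::
  "('k, 'x) ring_scheme \<Rightarrow> ('k, 'a, 'y) bihom_scheme \<Rightarrow> ('k, 'b, 'z) bihom_scheme \<Rightarrow> ('a \<Rightarrow> 'b) set"
  where "bihom_assoc_homs K A B = {f \<in> bihom_linear_maps K A B.
    \<forall>x\<in>carrier A. \<forall>y\<in>carrier A. f (x \<otimes>\<^bsub>A\<^esub> y) = f x \<otimes>\<^bsub>B\<^esub> f y}"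

definition bihom_ns_homs ::
  "('k, 'x) ring_scheme \<Rightarrow> ('k, 'a, 'y) bihom_ns_scheme \<Rightarrow> ('k, 'b, 'z) bihom_ns_scheme
    \<Rightarrow> ('a \<Rightarrow> 'b) set"
  where "bihom_ns_homs K A B = {f \<in> bihom_linear_maps K A B.
    \<forall>x\<in>carrier A. \<forall>y\<in>carrier A.
      f (x \<prec>\<^bsub>A\<^esub> y) = f x \<prec>\<^bsub>B\<^esub> f y \<and>
      f (x \<succ>\<^bsub>A\<^esub> y) = f x \<succ>\<^bsub>B\<^esub> f y \<and>
      f (x \<diamondop>\<^bsub>A\<^esub> y) = f x \<diamondop>\<^bsub>B\<^esub> f y}"

definition BHNS ::
  "('k, 'x) ring_scheme \<Rightarrow> (('k, 'u) bihom_ns, 'u \<Rightarrow> 'u) category"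
  where "BHNS K = \<lparr>
    Ob = {A. bihom_ns_algebra K A},
    Hom = bihom_ns_homs K,
    Id = (\<lambda>A. \<lambda>x\<in>carrier A. x),
    Comp = (\<lambda>A B C g f. compose (carrier A) g f)\<rparr>"

record ('k, 'a, 'm) trb =
  alg :: "('k, 'a) bihom"
  bim :: "('k, 'm) bihom"
  lact :: "'a \<Rightarrow> 'm \<Rightarrow> 'm"
  ract :: "'m \<Rightarrow> 'a \<Rightarrow> 'm"
  cocyc :: "'a \<Rightarrow> 'a \<Rightarrow> 'm"
  rbop :: "'m \<Rightarrow> 'a"

definition trb_homs ::
  "('k, 'x) ring_scheme \<Rightarrow> ('k, 'a, 'm) trb \<Rightarrow> ('k, 'b, 'n) trb \<Rightarrow> (('a \<Rightarrow> 'b) \<times> ('m \<Rightarrow> 'n)) set"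
  where "trb_homs K X Y = {(\<phi>, \<psi>).
    \<phi> \<in> bihom_assoc_homs K (alg X) (alg Y) \<and>
    \<psi> \<in> bihom_linear_maps K (bim X) (bim Y) \<and>
    (\<forall>x\<in>carrier (alg X). \<forall>m\<in>carrier (bim X).
      \<psi> (lact X x m) = lact Y (\<phi> x) (\<psi> m) \<and>
      \<psi> (ract X m x) = ract Y (\<psi> m) (\<phi> x)) \<and>
    (\<forall>x\<in>carrier (alg X). \<forall>y\<in>carrier (alg X). \<psi> (cocyc X x y) = cocyc Y (\<phi> x) (\<phi> y)) \<and>
    (\<forall>m\<in>carrier (bim X). \<phi> (rbop X m) = rbop Y (\<psi> m))}"

definition TRB ::
  "('k, 'x) ring_scheme \<Rightarrow> (('k, 'a, 'm) trb, ('a \<Rightarrow> 'a) \<times> ('m \<Rightarrow> 'm)) category"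
  where "TRB K = \<lparr>
    Ob = {X. twisted_rota_baxter K (alg X) (bim X) (lact X) (ract X) (cocyc X) (rbop X)},
    Hom = trb_homs K,
    Id = (\<lambda>X. (\<lambda>x\<in>carrier (alg X). x, \<lambda>m\<in>carrier (bim X). m)),
    Comp = (\<lambda>X Y Z g f. (compose (carrier (alg X)) (fst g) (fst f),
                         compose (carrier (bim X)) (snd g) (snd f)))\<rparr>"


section \<open>The two functors\<close>

definition G_ob :: "('k, 'a, 'm) trb \<Rightarrow> ('k, 'm) bihom_ns"
  where "G_ob X = \<lparr>
    carrier = carrier (bim X), mult = mult (bim X), one = one (bim X),
    zero = zero (bim X), add = add (bim X), smult = smult (bim X),
    alpha = alpha (bim X), beta = beta (bim X),
    prec = (\<lambda>m n. ract X m (rbop X n)),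
    succ = (\<lambda>m n. lact X (rbop X m) n),
    vee = (\<lambda>m n. cocyc X (rbop X m) (rbop X n))\<rparr>"

definition G_functor ::
  "(('k, 'a, 'm) trb, ('a \<Rightarrow> 'a) \<times> ('m \<Rightarrow> 'm), ('k, 'm) bihom_ns, 'm \<Rightarrow> 'm) cat_functor"
  where "G_functor = \<lparr>on_Ob = G_ob, on_Hom = (\<lambda>X Y f. snd f)\<rparr>"

definition bhas :: "('k, 'a) bihom_ns \<Rightarrow> ('k, 'a) bihom"
  where "bhas A = \<lparr>
    carrier = carrier A, mult = ns_star A, one = one A,
    zero = zero A, add = add A, smult = smult A,
    alpha = alpha A, beta = beta A\<rparr>"

definition F_ob :: "('k, 'a) bihom_ns \<Rightarrow> ('k, 'a, 'a) trb"
  where "F_ob A = \<lparr>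
    alg = bhas A,
    bim = bihom.truncate A,
    lact = succ A,
    ract = prec A,
    cocyc = vee A,
    rbop = (\<lambda>m. m)\<rparr>"

definition F_functor ::
  "(('k, 'a) bihom_ns, 'a \<Rightarrow> 'a, ('k, 'a, 'a) trb, ('a \<Rightarrow> 'a) \<times> ('a \<Rightarrow> 'a)) cat_functor"
  where "F_functor = \<lparr>on_Ob = F_ob, on_Hom = (\<lambda>A B f. (f, f))\<rparr>"

end

theory Submission
  imports Defs
begin

text \<open>
  A morphism \<open>(\<phi>, \<psi>)\<close> from \<open>F A\<close> to \<open>(\<pi>, H)\<close> is determined by \<open>\<psi>\<close>: the Rota-Baxter operator
  of \<open>F A\<close> is the identity, so the compatibility condition reads \<open>\<phi> = \<pi> \<circ> \<psi>\<close>. Substituting this,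
  the remaining conditions on \<open>(\<phi>, \<psi>)\<close> say exactly that \<open>\<psi>\<close> is a morphism of BiHom-NS-algebras
  from \<open>A\<close> to \<open>G (\<pi>, H)\<close>. Hence the second projection is the adjunction bijection.
\<close>

section \<open>Linear and bilinear maps\<close>

text \<open>The module axioms on the vector side read only these four fields, so they transfer to
  the rebuilt records \<open>G_ob X\<close>, \<open>bhas A\<close> and
  \<open>bihom.truncate A\<close>.\<close>

lemma module_cong:
  assumes "module K V"
    and "carrier W = carrier V" "add W = add V" "zero W = zero V" "smult W = smult V"
  shows "module K W"
proof -
  interpret module K V by fact
  have "abelian_group W"
    using M.l_neg by (intro abelian_groupI) (auto simp: assms(2-) M.a_ac)
  then show ?thesis
    by (intro moduleI)
      (auto simp: assms(2-) smult_l_distr smult_r_distr smult_assoc1 intro: is_cring)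
qed

lemma linear_maps_closed: "\<lbrakk>f \<in> linear_maps K V W; x \<in> carrier V\<rbrakk> \<Longrightarrow> f x \<in> carrier W"
  by (auto simp: linear_maps_def)

lemma linear_maps_add:
  "\<lbrakk>f \<in> linear_maps K V W; x \<in> carrier V; y \<in> carrier V\<rbrakk> \<Longrightarrow> f (x \<oplus>\<^bsub>V\<^esub> y) = f x \<oplus>\<^bsub>W\<^esub> f y"
  by (simp add: linear_maps_def)

lemma linear_maps_id: "(\<lambda>x. x) \<in> linear_maps K V V"
  by (simp add: linear_maps_def)

lemma linear_maps_comp:
  assumes "f \<in> linear_maps K U V" "g \<in> linear_maps K V W"
  shows "(\<lambda>x. g (f x)) \<in> linear_maps K U W"
  using assms by (auto simp: linear_maps_def Pi_iff)

text \<open>The carrier is closed under addition and scalar multiplication, so the linearity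
  conditions never see values off it. This turns linear maps into extensional ones.\<close>

lemma linear_maps_restrict:
  assumes "module K V" "f \<in> linear_maps K V W"
  shows "restrict f (carrier V) \<in> linear_maps K V W"
proof -
  interpret module K V by fact
  show ?thesis
    using assms by (auto simp: linear_maps_def)
qed

lemma linear_maps_plus:
  assumes "module K W" "f \<in> linear_maps K V W" "g \<in> linear_maps K V W"
  shows "(\<lambda>x. f x \<oplus>\<^bsub>W\<^esub> g x) \<in> linear_maps K V W"
proof -
  interpret module K W by fact
  show ?thesis
    using assms by (auto simp: linear_maps_def Pi_iff smult_r_distr M.a_ac)
qed

section \<open>Bilinear maps\<close>

lemma bilinear_maps_closed:
  "\<lbrakk>f \<in> bilinear_maps K U V W; x \<in> carrier U; y \<in> carrier V\<rbrakk> \<Longrightarrow> f x y \<in> carrier W"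
  by (auto simp: bilinear_maps_def linear_maps_def)

lemma bilinear_maps_add_left:
  "\<lbrakk>f \<in> bilinear_maps K U V W; x \<in> carrier U; x' \<in> carrier U; y \<in> carrier V\<rbrakk>
    \<Longrightarrow> f (x \<oplus>\<^bsub>U\<^esub> x') y = f x y \<oplus>\<^bsub>W\<^esub> f x' y"
  by (simp add: bilinear_maps_def linear_maps_def)

lemma bilinear_maps_add_right:
  "\<lbrakk>f \<in> bilinear_maps K U V W; x \<in> carrier U; y \<in> carrier V; y' \<in> carrier V\<rbrakk>
    \<Longrightarrow> f x (y \<oplus>\<^bsub>V\<^esub> y') = f x y \<oplus>\<^bsub>W\<^esub> f x y'"
  by (simp add: bilinear_maps_def linear_maps_def)

lemma bilinear_maps_plus:
  assumes "module K W" "f \<in> bilinear_maps K U V W" "g \<in> bilinear_maps K U V W"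
  shows "(\<lambda>x y. f x y \<oplus>\<^bsub>W\<^esub> g x y) \<in> bilinear_maps K U V W"
  using assms by (auto simp: bilinear_maps_def intro: linear_maps_plus)

text \<open>The operations of \<open>G_ob X\<close> arise this way: an action or the cocycle with
  \<open>rbop X\<close> or the identity inserted in each argument.\<close>

lemma bilinear_maps_comp:
  assumes "f \<in> bilinear_maps K U' V' W" "g \<in> linear_maps K U U'" "h \<in> linear_maps K V V'"
  shows "(\<lambda>x y. f (g x) (h y)) \<in> bilinear_maps K U V W"
proof -
  have "(\<lambda>y. f (g x) (h y)) \<in> linear_maps K V W" if "x \<in> carrier U" for x
    using linear_maps_comp[OF assms(3), where g = "f (g x)" and W = W] assms(1)
      linear_maps_closed[OF assms(2) that]
    by (simp add: bilinear_maps_def)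
  moreover have "(\<lambda>x. f (g x) (h y)) \<in> linear_maps K U W" if "y \<in> carrier V" for y
    using linear_maps_comp[OF assms(2), where g = "\<lambda>x. f x (h y)" and W = W] assms(1)
      linear_maps_closed[OF assms(3) that]
    by (simp add: bilinear_maps_def)
  ultimately show ?thesis
    by (simp add: bilinear_maps_def)
qed

section \<open>BiHom spaces and composition of their morphisms\<close>

lemma (in bihom_space) bihom_space_closed [simp]:
  "x \<in> carrier V \<Longrightarrow> alpha V x \<in> carrier V" "x \<in> carrier V \<Longrightarrow> beta V x \<in> carrier V"
  using alpha_linear beta_linear by (auto intro: linear_maps_closed)

lemma bihom_space_cong:
  assumes "bihom_space K V"
    and "carrier W = carrier V" "add W = add V" "zero W = zero V" "smult W = smult V"
    and "alpha W = alpha V" "beta W = beta V"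
  shows "bihom_space K W"
  using assms module_cong[of K V W]
  by (simp add: bihom_space_def bihom_space_axioms_def linear_maps_def)

lemma bihom_linear_maps_closed:
  "\<lbrakk>f \<in> bihom_linear_maps K V W; x \<in> carrier V\<rbrakk> \<Longrightarrow> f x \<in> carrier W"
  by (auto simp: bihom_linear_maps_def intro: linear_maps_closed)

lemma bihom_linear_maps_id:
  assumes "bihom_space K V"
  shows "restrict (\<lambda>x. x) (carrier V) \<in> bihom_linear_maps K V V"
proof -
  interpret bihom_space K V by fact
  show ?thesis
    using linear_maps_restrict[OF module_axioms linear_maps_id]
    by (simp add: bihom_linear_maps_def)
qed

lemma bihom_linear_maps_compose:
  assumes "bihom_space K U" "f \<in> bihom_linear_maps K U V" "g \<in> bihom_linear_maps K V W"
  shows "compose (carrier U) g f \<in> bihom_linear_maps K U W"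
proof -
  interpret bihom_space K U by fact
  \<comment> \<open>\<open>compose\<close> is the ordinary composite restricted to the carrier, so
    \<open>linear_maps_restrict\<close> applies.\<close>
  have "compose (carrier U) g f \<in> linear_maps K U W"
    unfolding compose_def using assms
    by (auto simp: bihom_linear_maps_def
        intro!: linear_maps_restrict[OF module_axioms linear_maps_comp[of f K U V g W]])
  then show ?thesis
    using assms(2,3) bihom_linear_maps_closed[OF assms(2)]
    by (simp add: bihom_linear_maps_def compose_eq)
qed

text \<open>Extensionality makes these equalities of functions: off \<open>carrier V\<close> both
  sides are \<open>undefined\<close>.\<close>

lemma bihom_linear_maps_compose_id:
  assumes "f \<in> bihom_linear_maps K V W"
  shows "compose (carrier V) f (restrict (\<lambda>x. x) (carrier V)) = f"
    and "compose (carrier V) (restrict (\<lambda>x. x) (carrier W)) f = f"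
  using assms bihom_linear_maps_closed[OF assms]
  by (auto simp: bihom_linear_maps_def compose_def extensional_def fun_eq_iff)

text \<open>The composite restricted to \<open>carrier V\<close> is evaluated only at values of
  \<open>f\<close>, which lie there.\<close>

lemma bihom_linear_maps_compose_assoc:
  assumes "f \<in> bihom_linear_maps K U V"
  shows "compose (carrier U) (compose (carrier V) h g) f = compose (carrier U) h (compose (carrier U) g f)"
  using bihom_linear_maps_closed[OF assms] by (auto simp: compose_def fun_eq_iff)


section \<open>The category axioms\<close>

lemma category_BHNS: "category (BHNS K)"
proof (unfold_locales, goal_cases)
  case (1 X)
  then interpret bihom_ns_algebra K X by (simp add: BHNS_def)
  \<comment> \<open>The identity is restricted to the carrier, so it can be evaluated at a product
    only once that product is known to lie there.\<close>
  note [simp] = bilinear_maps_closed[OF prec_bilinear] bilinear_maps_closed[OF succ_bilinear]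
    bilinear_maps_closed[OF vee_bilinear]
  show ?case
    using bihom_linear_maps_id[OF bihom_space_axioms] by (simp add: BHNS_def bihom_ns_homs_def)
next
  case (2 X Y Z f g)
  then interpret bihom_ns_algebra K X by (simp add: BHNS_def)
  note [simp] = bilinear_maps_closed[OF prec_bilinear] bilinear_maps_closed[OF succ_bilinear]
    bilinear_maps_closed[OF vee_bilinear]
  have f: "f \<in> bihom_linear_maps K X Y" and g: "g \<in> bihom_linear_maps K Y Z"
    using 2 by (simp_all add: BHNS_def bihom_ns_homs_def)
  show ?case
    using 2 bihom_linear_maps_compose[OF bihom_space_axioms f g] bihom_linear_maps_closed[OF f]
    by (simp add: BHNS_def bihom_ns_homs_def compose_eq)
next
  case (3 X Y f)
  then have "f \<in> bihom_linear_maps K X Y"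
    by (simp add: BHNS_def bihom_ns_homs_def)
  then show ?case
    by (simp add: BHNS_def bihom_linear_maps_compose_id)
next
  case (4 X Y f)
  then have "f \<in> bihom_linear_maps K X Y"
    by (simp add: BHNS_def bihom_ns_homs_def)
  then show ?case
    by (simp add: BHNS_def bihom_linear_maps_compose_id)
next
  case (5 W X Y Z f g h)
  then have "f \<in> bihom_linear_maps K W X"
    by (simp add: BHNS_def bihom_ns_homs_def)
  then show ?case
    by (simp add: BHNS_def bihom_linear_maps_compose_assoc)
qed

text \<open>The unit laws and associativity in \<open>TRB K\<close> hold componentwise and follow
  from this linear information alone.\<close>

lemma trb_homs_linear:
  assumes "(\<phi>, \<psi>) \<in> trb_homs K X Y"
  shows "\<phi> \<in> bihom_linear_maps K (alg X) (alg Y)" "\<psi> \<in> bihom_linear_maps K (bim X) (bim Y)"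
  using assms by (auto simp: trb_homs_def bihom_assoc_homs_def)

lemma category_TRB: "category (TRB K)"
proof (unfold_locales, goal_cases)
  case (1 X)
  then interpret twisted_rota_baxter K "alg X" "bim X" "lact X" "ract X" "cocyc X" "rbop X"
    by (simp add: TRB_def)
  note [simp] = bilinear_maps_closed[OF algebra.mult_bilinear] bilinear_maps_closed[OF l_bilinear]
    bilinear_maps_closed[OF r_bilinear] bilinear_maps_closed[OF H_bilinear]
    linear_maps_closed[OF p_linear]
  show ?case
    using bihom_linear_maps_id[OF algebra.bihom_space_axioms]
      bihom_linear_maps_id[OF space.bihom_space_axioms]
    by (simp add: TRB_def trb_homs_def bihom_assoc_homs_def)
next
  case (2 X Y Z f g)
  then interpret twisted_rota_baxter K "alg X" "bim X" "lact X" "ract X" "cocyc X" "rbop X"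
    by (simp add: TRB_def)
  note [simp] = bilinear_maps_closed[OF algebra.mult_bilinear] bilinear_maps_closed[OF l_bilinear]
    bilinear_maps_closed[OF r_bilinear] bilinear_maps_closed[OF H_bilinear]
    linear_maps_closed[OF p_linear]
  obtain \<phi> \<psi> \<phi>' \<psi>' where fg: "f = (\<phi>, \<psi>)" "g = (\<phi>', \<psi>')"
    by (cases f, cases g)
  have f: "(\<phi>, \<psi>) \<in> trb_homs K X Y" and g: "(\<phi>', \<psi>') \<in> trb_homs K Y Z"
    using 2 by (simp_all add: TRB_def fg)
  note lin = trb_homs_linear[OF f] trb_homs_linear[OF g]
  note [simp] = bihom_linear_maps_closed[OF lin(1)] bihom_linear_maps_closed[OF lin(2)]
  show ?case
    using f g bihom_linear_maps_compose[OF algebra.bihom_space_axioms lin(1,3)]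
      bihom_linear_maps_compose[OF space.bihom_space_axioms lin(2,4)]
    by (simp add: TRB_def trb_homs_def bihom_assoc_homs_def compose_eq fg)
next
  case (3 X Y f)
  then have "(fst f, snd f) \<in> trb_homs K X Y"
    by (simp add: TRB_def)
  from trb_homs_linear[OF this] show ?case
    by (simp add: TRB_def bihom_linear_maps_compose_id)
next
  case (4 X Y f)
  then have "(fst f, snd f) \<in> trb_homs K X Y"
    by (simp add: TRB_def)
  from trb_homs_linear[OF this] show ?case
    by (simp add: TRB_def bihom_linear_maps_compose_id)
next
  case (5 W X Y Z f g h)
  then have "(fst f, snd f) \<in> trb_homs K W X"
    by (simp add: TRB_def)
  from trb_homs_linear[OF this] show ?case
    by (simp add: TRB_def bihom_linear_maps_compose_assoc)
qed


section \<open>The functor \<open>G\<close>\<close>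

text \<open>Translates between the cocycle condition, an alternating sum equal to zero, and the
  fourth NS axiom, which has a sum of two terms on each side.\<close>

lemma (in abelian_group) minus_plus_minus_eq_zero_iff:
  assumes "a \<in> carrier G" "b \<in> carrier G" "c \<in> carrier G" "d \<in> carrier G"
  shows "a \<ominus> b \<oplus> c \<ominus> d = \<zero> \<longleftrightarrow> d \<oplus> b = a \<oplus> c"
proof -
  have "a \<ominus> b \<oplus> c \<ominus> d = (a \<oplus> c) \<ominus> (d \<oplus> b)"
    using assms by (simp add: minus_eq minus_add a_ac)
  moreover have "a \<oplus> c = ((a \<oplus> c) \<ominus> (d \<oplus> b)) \<oplus> (d \<oplus> b)"
    using assms by (simp add: minus_eq a_assoc l_neg del: minus_add)
  ultimately show ?thesis
    using assms by (auto simp: minus_eq r_neg)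
qed

text \<open>At images under \<open>rbop X\<close>, the axioms \<open>r_r\<close>,
  \<open>l_r\<close>, \<open>l_l\<close> and \<open>cocycle\<close> become \<open>prec_prec\<close>,
  \<open>succ_prec\<close>, \<open>star_succ\<close> and \<open>vee_prec\<close>. The link is the
  Rota-Baxter identity: \<open>rbop X\<close> carries the NS product of \<open>G_ob X\<close> to the
  product of the algebra.\<close>

lemma bihom_ns_algebra_G_ob:
  assumes "twisted_rota_baxter K (alg X) (bim X) (lact X) (ract X) (cocyc X) (rbop X)"
  shows "bihom_ns_algebra K (G_ob X)"
proof -
  interpret twisted_rota_baxter K "alg X" "bim X" "lact X" "ract X" "cocyc X" "rbop X" by fact
  note [simp] = bilinear_maps_closed[OF algebra.mult_bilinear] bilinear_maps_closed[OF l_bilinear]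
    bilinear_maps_closed[OF r_bilinear] bilinear_maps_closed[OF H_bilinear]
    linear_maps_closed[OF p_linear]
  have G_bilinear: "bilinear_maps K (bim X) (bim X) (bim X) = bilinear_maps K (G_ob X) (G_ob X) (G_ob X)"
    by (simp add: bilinear_maps_def linear_maps_def G_ob_def)
  have space: "bihom_space K (G_ob X)"
    by (rule bihom_space_cong[OF space.bihom_space_axioms]) (simp_all add: G_ob_def)
  \<comment> \<open>The Rota-Baxter identity lists the left action first, whereas
    \<open>ns_star\<close> starts with \<open>prec\<close>; commutativity of addition reconciles
    them.\<close>
  have star_closed: "m \<star>\<^bsub>G_ob X\<^esub> n \<in> carrier (bim X)"
    and p_star: "rbop X (m \<star>\<^bsub>G_ob X\<^esub> n) = rbop X m \<otimes>\<^bsub>alg X\<^esub> rbop X n"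
    if "m \<in> carrier (bim X)" "n \<in> carrier (bim X)" for m n
    using that by (simp_all add: rota_baxter ns_star_def G_ob_def space.M.a_comm)
  have vee_prec:
    "ract X (cocyc X (rbop X m) (rbop X n)) (beta (alg X) (rbop X q)) \<oplus>\<^bsub>bim X\<^esub>
      cocyc X (rbop X m \<otimes>\<^bsub>alg X\<^esub> rbop X n) (beta (alg X) (rbop X q)) =
     lact X (alpha (alg X) (rbop X m)) (cocyc X (rbop X n) (rbop X q)) \<oplus>\<^bsub>bim X\<^esub>
      cocyc X (alpha (alg X) (rbop X m)) (rbop X n \<otimes>\<^bsub>alg X\<^esub> rbop X q)"
    if "m \<in> carrier (bim X)" "n \<in> carrier (bim X)" "q \<in> carrier (bim X)" for m n q
    using cocycle[of "rbop X m" "rbop X n" "rbop X q"] that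
    by (subst space.M.minus_plus_minus_eq_zero_iff[symmetric]) simp_all
  \<comment> \<open>Rewriting only these selectors keeps \<open>G_ob X\<close> folded inside
    \<open>ns_star\<close>, so that \<open>p_star\<close> and \<open>star_closed\<close> still
    match.\<close>
  have simps: "carrier (G_ob X) = carrier (bim X)" "add (G_ob X) = add (bim X)"
    "alpha (G_ob X) = alpha (bim X)" "beta (G_ob X) = beta (bim X)"
    "\<And>m n. m \<prec>\<^bsub>G_ob X\<^esub> n = ract X m (rbop X n)"
    "\<And>m n. m \<succ>\<^bsub>G_ob X\<^esub> n = lact X (rbop X m) n"
    "\<And>m n. m \<diamondop>\<^bsub>G_ob X\<^esub> n = cocyc X (rbop X m) (rbop X n)"
    by (simp_all add: G_ob_def)
  note id_linear = linear_maps_id[of K "bim X"]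
  have "prec (G_ob X) \<in> bilinear_maps K (G_ob X) (G_ob X) (G_ob X)"
    "succ (G_ob X) \<in> bilinear_maps K (G_ob X) (G_ob X) (G_ob X)"
    "vee (G_ob X) \<in> bilinear_maps K (G_ob X) (G_ob X) (G_ob X)"
    using bilinear_maps_comp[OF r_bilinear id_linear p_linear]
      bilinear_maps_comp[OF l_bilinear p_linear id_linear]
      bilinear_maps_comp[OF H_bilinear p_linear p_linear]
    unfolding G_bilinear by (simp_all add: G_ob_def)
  with space show ?thesis
    unfolding bihom_ns_algebra_def bihom_ns_algebra_axioms_def simps
    by (simp add: p_alpha p_beta alpha_l beta_l alpha_r beta_r H_alpha H_beta
        p_star star_closed l_l r_r l_r vee_prec)
qed

lemma cat_functor_G: "cat_functor (TRB K) (BHNS K) G_functor"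
proof -
  interpret source: category "TRB K" by (rule category_TRB)
  interpret target: category "BHNS K" by (rule category_BHNS)
  show ?thesis
  proof (unfold_locales, goal_cases)
    case (1 X)
    then show ?case
      by (simp add: TRB_def BHNS_def G_functor_def bihom_ns_algebra_G_ob)
  next
    case (2 X Y f)
    then interpret twisted_rota_baxter K "alg X" "bim X" "lact X" "ract X" "cocyc X" "rbop X"
      by (simp add: TRB_def)
    obtain \<phi> \<psi> where f: "f = (\<phi>, \<psi>)" by (cases f)
    have "(\<phi>, \<psi>) \<in> trb_homs K X Y"
      using 2 by (simp add: TRB_def f)
    moreover have "\<psi> \<in> bihom_linear_maps K (G_ob X) (G_ob Y)"
      using trb_homs_linear(2)[OF calculation]
      by (simp add: bihom_linear_maps_def linear_maps_def G_ob_def)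
    \<comment> \<open>Since \<phi> intertwines the two Rota-Baxter operators, compatibility of
      \<psi> with the actions and cocycles, taken at values of \<open>rbop X\<close>, is
      preservation of the NS operations.\<close>
    ultimately have "\<psi> \<in> bihom_ns_homs K (G_ob X) (G_ob Y)"
      using linear_maps_closed[OF p_linear]
      by (simp add: bihom_ns_homs_def trb_homs_def) (simp add: G_ob_def)
    then show ?case
      by (simp add: BHNS_def G_functor_def f)
  qed (simp_all add: TRB_def BHNS_def G_functor_def G_ob_def)
qed


section \<open>The functor \<open>F\<close>\<close>

lemma bhas_simps [simp]:
  "carrier (bhas A) = carrier A" "mult (bhas A) = ns_star A" "zero (bhas A) = zero A"
  "add (bhas A) = add A" "smult (bhas A) = smult A" "alpha (bhas A) = alpha A" "beta (bhas A) = beta A"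
  by (simp_all add: bhas_def)

lemma truncate_simps [simp]:
  "carrier (bihom.truncate A) = carrier A" "zero (bihom.truncate A) = zero A"
  "add (bihom.truncate A) = add A" "smult (bihom.truncate A) = smult A"
  "alpha (bihom.truncate A) = alpha A" "beta (bihom.truncate A) = beta A"
  by (simp_all add: bihom.truncate_def)

lemma linear_maps_bhas_truncate [simp]:
  "linear_maps K (bhas A) W = linear_maps K A W"
  "linear_maps K (bihom.truncate A) W = linear_maps K A W"
  "linear_maps K V (bhas A) = linear_maps K V A"
  "linear_maps K V (bihom.truncate A) = linear_maps K V A"
  by (simp_all add: linear_maps_def)

lemma bilinear_maps_bhas_truncate [simp]:
  "bilinear_maps K (bhas A) V W = bilinear_maps K A V W"
  "bilinear_maps K (bihom.truncate A) V W = bilinear_maps K A V W"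
  "bilinear_maps K U (bhas A) W = bilinear_maps K U A W"
  "bilinear_maps K U (bihom.truncate A) W = bilinear_maps K U A W"
  "bilinear_maps K U V (bhas A) = bilinear_maps K U V A"
  "bilinear_maps K U V (bihom.truncate A) = bilinear_maps K U V A"
  by (simp_all add: bilinear_maps_def)

lemma F_ob_simps [simp]:
  "alg (F_ob A) = bhas A" "bim (F_ob A) = bihom.truncate A" "lact (F_ob A) = succ A"
  "ract (F_ob A) = prec A" "cocyc (F_ob A) = vee A" "rbop (F_ob A) = (\<lambda>m. m)"
  by (simp_all add: F_ob_def)

section \<open>The BiHom-associative algebra and the cocycle of a BiHom-NS-algebra\<close>

lemma (in bihom_ns_algebra) ns_closed [simp]:
  assumes "x \<in> carrier A" "y \<in> carrier A"
  shows "x \<prec>\<^bsub>A\<^esub> y \<in> carrier A" "x \<succ>\<^bsub>A\<^esub> y \<in> carrier A" "x \<diamondop>\<^bsub>A\<^esub> y \<in> carrier A" "x \<star>\<^bsub>A\<^esub> y \<in> carrier A"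
  using assms bilinear_maps_closed[OF prec_bilinear] bilinear_maps_closed[OF succ_bilinear]
    bilinear_maps_closed[OF vee_bilinear]
  by (simp_all add: ns_star_def)

text \<open>Both sides expand to five terms. The first three NS axioms match one term each, and the
  fourth matches the remaining pair.\<close>

lemma (in bihom_ns_algebra) star_assoc:
  assumes "x \<in> carrier A" "y \<in> carrier A" "z \<in> carrier A"
  shows "alpha A x \<star>\<^bsub>A\<^esub> (y \<star>\<^bsub>A\<^esub> z) = (x \<star>\<^bsub>A\<^esub> y) \<star>\<^bsub>A\<^esub> beta A z"
proof -
  note [simp] = assms
  \<comment> \<open>The inner product is expanded only as an argument of \<open>succ\<close>; under
    \<open>prec\<close> and \<open>vee\<close> the axioms keep it whole.\<close>
  have succ: "alpha A x \<succ>\<^bsub>A\<^esub> (y \<star>\<^bsub>A\<^esub> z) = (x \<succ>\<^bsub>A\<^esub> y) \<prec>\<^bsub>A\<^esub> beta A z \<oplus>\<^bsub>A\<^esub> (x \<star>\<^bsub>A\<^esub> y) \<succ>\<^bsub>A\<^esub> beta A z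
      \<oplus>\<^bsub>A\<^esub> alpha A x \<succ>\<^bsub>A\<^esub> (y \<diamondop>\<^bsub>A\<^esub> z)"
    unfolding ns_star_def[of A y z]
    by (simp add: bilinear_maps_add_right[OF succ_bilinear] succ_prec star_succ)
  have prec: "(x \<star>\<^bsub>A\<^esub> y) \<prec>\<^bsub>A\<^esub> beta A z = alpha A x \<prec>\<^bsub>A\<^esub> (y \<star>\<^bsub>A\<^esub> z) \<oplus>\<^bsub>A\<^esub> (x \<succ>\<^bsub>A\<^esub> y) \<prec>\<^bsub>A\<^esub> beta A z
      \<oplus>\<^bsub>A\<^esub> (x \<diamondop>\<^bsub>A\<^esub> y) \<prec>\<^bsub>A\<^esub> beta A z"
    unfolding ns_star_def[of A x y]
    by (simp add: bilinear_maps_add_left[OF prec_bilinear] prec_prec)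
  \<comment> \<open>The bracketing isolates the last two terms as the right-hand side of
    \<open>vee_prec\<close>.\<close>
  have "alpha A x \<star>\<^bsub>A\<^esub> (y \<star>\<^bsub>A\<^esub> z) = alpha A x \<prec>\<^bsub>A\<^esub> (y \<star>\<^bsub>A\<^esub> z)
      \<oplus>\<^bsub>A\<^esub> ((x \<succ>\<^bsub>A\<^esub> y) \<prec>\<^bsub>A\<^esub> beta A z \<oplus>\<^bsub>A\<^esub> (x \<star>\<^bsub>A\<^esub> y) \<succ>\<^bsub>A\<^esub> beta A z)
      \<oplus>\<^bsub>A\<^esub> (alpha A x \<succ>\<^bsub>A\<^esub> (y \<diamondop>\<^bsub>A\<^esub> z) \<oplus>\<^bsub>A\<^esub> alpha A x \<diamondop>\<^bsub>A\<^esub> (y \<star>\<^bsub>A\<^esub> z))"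
    unfolding ns_star_def[of A "alpha A x" "y \<star>\<^bsub>A\<^esub> z"] succ by (simp add: M.a_assoc)
  also have "\<dots> = alpha A x \<prec>\<^bsub>A\<^esub> (y \<star>\<^bsub>A\<^esub> z)
      \<oplus>\<^bsub>A\<^esub> ((x \<succ>\<^bsub>A\<^esub> y) \<prec>\<^bsub>A\<^esub> beta A z \<oplus>\<^bsub>A\<^esub> (x \<star>\<^bsub>A\<^esub> y) \<succ>\<^bsub>A\<^esub> beta A z)
      \<oplus>\<^bsub>A\<^esub> ((x \<diamondop>\<^bsub>A\<^esub> y) \<prec>\<^bsub>A\<^esub> beta A z \<oplus>\<^bsub>A\<^esub> (x \<star>\<^bsub>A\<^esub> y) \<diamondop>\<^bsub>A\<^esub> beta A z)"
    by (simp only: vee_prec[OF assms])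
  also have "\<dots> = (x \<star>\<^bsub>A\<^esub> y) \<star>\<^bsub>A\<^esub> beta A z"
    unfolding ns_star_def[of A "x \<star>\<^bsub>A\<^esub> y" "beta A z"] prec by (simp add: M.a_ac)
  finally show ?thesis .
qed

text \<open>The first three NS axioms are the mixed bimodule axioms and the fourth is the cocycle
  condition. With the identity as operator, the Rota-Baxter identity is the definition of
  \<open>ns_star\<close> up to the order of summands.\<close>

lemma twisted_rota_baxter_F_ob:
  assumes "bihom_ns_algebra K A"
  shows "twisted_rota_baxter K (alg (F_ob A)) (bim (F_ob A)) (lact (F_ob A)) (ract (F_ob A))
    (cocyc (F_ob A)) (rbop (F_ob A))"
proof -
  interpret bihom_ns_algebra K A by fact
  have spaces: "bihom_space K (bhas A)" "bihom_space K (bihom.truncate A)"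
    by (auto intro: bihom_space_cong[OF bihom_space_axioms])
  interpret T: bihom_space K "bihom.truncate A" by (rule spaces(2))
  have "ns_star A = (\<lambda>x y. x \<prec>\<^bsub>A\<^esub> y \<oplus>\<^bsub>A\<^esub> x \<succ>\<^bsub>A\<^esub> y \<oplus>\<^bsub>A\<^esub> x \<diamondop>\<^bsub>A\<^esub> y)"
    by (simp add: ns_star_def fun_eq_iff)
  then have star_bilinear: "ns_star A \<in> bilinear_maps K A A A"
    by (simp add: bilinear_maps_plus module_axioms prec_bilinear succ_bilinear vee_bilinear)
  \<comment> \<open>Associativity uses \<open>ns_star\<close> folded; multiplicativity of the
    structure maps is left for a second pass that expands it.\<close>
  have algebra: "bihom_assoc_algebra K (bhas A)"
    using spaces(1)
    by (auto simp: bihom_assoc_algebra_def bihom_assoc_algebra_axioms_def star_bilinear star_assoc)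
      (simp_all add: ns_star_def linear_maps_add[OF alpha_linear] linear_maps_add[OF beta_linear]
        alpha_prec alpha_succ alpha_vee beta_prec beta_succ beta_vee)
  have bimodule: "bihom_bimodule K (bhas A) (bihom.truncate A) (succ A) (prec A)"
    using algebra spaces(2)
    by (auto simp: bihom_bimodule_def bihom_bimodule_axioms_def succ_bilinear prec_bilinear
        alpha_prec alpha_succ beta_prec beta_succ prec_prec succ_prec star_succ)
  \<comment> \<open>Subtraction is a derived operation taking the whole record, not a field, so it
    stays attached to \<open>bihom.truncate A\<close>; the interpretation \<open>T\<close> supplies
    the group laws there.\<close>
  have cocycle: "alpha A x \<succ>\<^bsub>A\<^esub> (y \<diamondop>\<^bsub>A\<^esub> z) \<ominus>\<^bsub>bihom.truncate A\<^esub> (x \<star>\<^bsub>A\<^esub> y) \<diamondop>\<^bsub>A\<^esub> beta A z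
      \<oplus>\<^bsub>A\<^esub> alpha A x \<diamondop>\<^bsub>A\<^esub> (y \<star>\<^bsub>A\<^esub> z) \<ominus>\<^bsub>bihom.truncate A\<^esub> (x \<diamondop>\<^bsub>A\<^esub> y) \<prec>\<^bsub>A\<^esub> beta A z = \<zero>\<^bsub>A\<^esub>"
    if "x \<in> carrier A" "y \<in> carrier A" "z \<in> carrier A" for x y z
    using T.M.minus_plus_minus_eq_zero_iff[of "alpha A x \<succ>\<^bsub>A\<^esub> (y \<diamondop>\<^bsub>A\<^esub> z)" "(x \<star>\<^bsub>A\<^esub> y) \<diamondop>\<^bsub>A\<^esub> beta A z"
        "alpha A x \<diamondop>\<^bsub>A\<^esub> (y \<star>\<^bsub>A\<^esub> z)" "(x \<diamondop>\<^bsub>A\<^esub> y) \<prec>\<^bsub>A\<^esub> beta A z"] vee_prec[OF that] that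
    by simp
  have "hochschild_2_cocycle K (bhas A) (bihom.truncate A) (succ A) (prec A) (vee A)"
    using bimodule
    by (auto simp: hochschild_2_cocycle_def hochschild_2_cocycle_axioms_def vee_bilinear
        alpha_vee beta_vee cocycle)
  moreover have "x \<star>\<^bsub>A\<^esub> y = x \<succ>\<^bsub>A\<^esub> y \<oplus>\<^bsub>A\<^esub> x \<prec>\<^bsub>A\<^esub> y \<oplus>\<^bsub>A\<^esub> x \<diamondop>\<^bsub>A\<^esub> y"
    if "x \<in> carrier A" "y \<in> carrier A" for x y
    using that by (simp add: ns_star_def M.a_comm)
  ultimately show ?thesis
    by (simp add: twisted_rota_baxter_def twisted_rota_baxter_axioms_def linear_maps_id)
qed

text \<open>Linearity distributes \<open>f\<close> over the three summands. This supplies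
  multiplicativity for \<open>F_functor\<close> on morphisms and for the lift of a morphism into
  \<open>G_ob X\<close>.\<close>

lemma bihom_ns_homs_star:
  assumes "bihom_ns_algebra K A" "f \<in> bihom_ns_homs K A B" "x \<in> carrier A" "y \<in> carrier A"
  shows "f (x \<star>\<^bsub>A\<^esub> y) = f x \<star>\<^bsub>B\<^esub> f y"
proof -
  interpret bihom_ns_algebra K A by fact
  have "f \<in> linear_maps K A B"
    using assms(2) by (simp add: bihom_ns_homs_def bihom_linear_maps_def)
  then show ?thesis
    using assms(2-) by (simp add: ns_star_def linear_maps_add[of f K] bihom_ns_homs_def)
qed

lemma cat_functor_F: "cat_functor (BHNS K) (TRB K) F_functor"
proof -
  interpret source: category "BHNS K" by (rule category_BHNS)
  interpret target: category "TRB K" by (rule category_TRB)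
  show ?thesis
  proof (unfold_locales, goal_cases)
    case (1 A)
    then show ?case
      using twisted_rota_baxter_F_ob[of K A] by (simp add: TRB_def BHNS_def F_functor_def)
  next
    case (2 A B f)
    then have A: "bihom_ns_algebra K A" and f: "f \<in> bihom_ns_homs K A B"
      by (simp_all add: BHNS_def)
    have "f \<in> bihom_linear_maps K (bhas A) (bhas B)"
      "f \<in> bihom_linear_maps K (bihom.truncate A) (bihom.truncate B)"
      using f by (simp_all add: bihom_ns_homs_def bihom_linear_maps_def linear_maps_def)
    then show ?case
      using f bihom_ns_homs_star[OF A f]
      by (simp add: TRB_def F_functor_def trb_homs_def bihom_assoc_homs_def bihom_ns_homs_def)
  qed (simp_all add: TRB_def BHNS_def F_functor_def)
qed


section \<open>The adjunction\<close>

text \<open>Compatibility with the identity operator gives \<phi> pointwise on the carrier, and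
  extensionality makes this an equality of functions; hence \<open>snd\<close> is injective on these
  morphisms.\<close>

lemma snd_trb_homs_F_ob:
  assumes f: "(\<phi>, \<psi>) \<in> trb_homs K (F_ob A) X"
  shows "\<psi> \<in> bihom_ns_homs K A (G_ob X)"
    and "\<phi> = restrict (\<lambda>x. rbop X (\<psi> x)) (carrier A)"
proof -
  have \<phi>: "\<phi> x = rbop X (\<psi> x)" if "x \<in> carrier A" for x
    using f that by (simp add: trb_homs_def)
  have "\<psi> \<in> bihom_linear_maps K A (G_ob X)"
    using trb_homs_linear(2)[OF f] by (simp add: bihom_linear_maps_def linear_maps_def G_ob_def)
  then show "\<psi> \<in> bihom_ns_homs K A (G_ob X)"
    using f by (simp add: bihom_ns_homs_def trb_homs_def) (simp add: G_ob_def \<phi>)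
  show "\<phi> = restrict (\<lambda>x. rbop X (\<psi> x)) (carrier A)"
    using trb_homs_linear(1)[OF f]
    by (auto simp: fun_eq_iff \<phi> bihom_linear_maps_def extensional_def)
qed

text \<open>This gives surjectivity of \<open>snd\<close>. The conditions linking the components
  hold because \<psi> preserves the NS operations of \<open>G_ob X\<close>, which are defined
  through \<open>rbop X\<close>.\<close>

lemma bihom_ns_hom_lift:
  assumes A: "bihom_ns_algebra K A"
    and X: "twisted_rota_baxter K (alg X) (bim X) (lact X) (ract X) (cocyc X) (rbop X)"
    and \<psi>: "\<psi> \<in> bihom_ns_homs K A (G_ob X)"
  shows "(restrict (\<lambda>x. rbop X (\<psi> x)) (carrier A), \<psi>) \<in> trb_homs K (F_ob A) X"
proof -
  interpret A: bihom_ns_algebra K A by (rule A)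
  interpret twisted_rota_baxter K "alg X" "bim X" "lact X" "ract X" "cocyc X" "rbop X" by (rule X)
  note [simp] = bilinear_maps_closed[OF l_bilinear] bilinear_maps_closed[OF r_bilinear]
    bilinear_maps_closed[OF H_bilinear] linear_maps_closed[OF p_linear]
  have lin: "\<psi> \<in> linear_maps K A (bim X)"
    using \<psi> by (simp add: bihom_ns_homs_def bihom_linear_maps_def linear_maps_def G_ob_def)
  note [simp] = linear_maps_closed[OF lin]
  have blin: "\<psi> \<in> bihom_linear_maps K (bihom.truncate A) (bim X)"
    using \<psi> by (simp add: bihom_ns_homs_def bihom_linear_maps_def linear_maps_def G_ob_def)
  let ?\<phi> = "restrict (\<lambda>x. rbop X (\<psi> x)) (carrier A)"
  have "?\<phi> \<in> linear_maps K (bhas A) (alg X)"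
    using linear_maps_restrict[OF A.module_axioms linear_maps_comp[OF lin p_linear]]
    by (simp add: linear_maps_def)
  then have \<phi>: "?\<phi> \<in> bihom_linear_maps K (bhas A) (alg X)"
    using blin by (simp add: bihom_linear_maps_def p_alpha p_beta)
  \<comment> \<open>\<psi> preserves \<open>ns_star\<close>, and the Rota-Baxter identity collapses
    \<open>rbop X\<close> of the resulting sum to a product.\<close>
  have "rbop X (\<psi> (x \<star>\<^bsub>A\<^esub> y)) = rbop X (\<psi> x) \<otimes>\<^bsub>alg X\<^esub> rbop X (\<psi> y)"
    if "x \<in> carrier A" "y \<in> carrier A" for x y
    using that
    by (simp add: bihom_ns_homs_star[OF A \<psi>] rota_baxter) (simp add: ns_star_def G_ob_def space.M.a_comm)
  moreover have "\<psi> (x \<prec>\<^bsub>A\<^esub> y) = ract X (\<psi> x) (rbop X (\<psi> y))"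
    "\<psi> (x \<succ>\<^bsub>A\<^esub> y) = lact X (rbop X (\<psi> x)) (\<psi> y)"
    "\<psi> (x \<diamondop>\<^bsub>A\<^esub> y) = cocyc X (rbop X (\<psi> x)) (rbop X (\<psi> y))"
    if "x \<in> carrier A" "y \<in> carrier A" for x y
    using that \<psi> by (simp_all add: bihom_ns_homs_def G_ob_def)
  ultimately show ?thesis
    using \<phi> blin by (simp add: trb_homs_def bihom_assoc_homs_def)
qed

theorem theorem3p5:
  fixes K :: "('k, 'x) ring_scheme"
  assumes "field K"
  shows "left_adjoint
    (BHNS K :: (('k, 'u) bihom_ns, 'u \<Rightarrow> 'u) category)
    (TRB K :: (('k, 'u, 'u) trb, ('u \<Rightarrow> 'u) \<times> ('u \<Rightarrow> 'u)) category)
    F_functor G_functor"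
proof -
  let ?C = "BHNS K :: (('k, 'u) bihom_ns, 'u \<Rightarrow> 'u) category"
  let ?D = "TRB K :: (('k, 'u, 'u) trb, ('u \<Rightarrow> 'u) \<times> ('u \<Rightarrow> 'u)) category"
  interpret F: cat_functor ?C ?D F_functor by (rule cat_functor_F)
  interpret G: cat_functor ?D ?C G_functor by (rule cat_functor_G)
  have "hom_adjunction ?C ?D F_functor G_functor (\<lambda>_ _. snd)"
  proof (unfold_locales, goal_cases)
    case (1 A X)
    then have A: "bihom_ns_algebra K A"
      and X: "twisted_rota_baxter K (alg X) (bim X) (lact X) (ract X) (cocyc X) (rbop X)"
      by (simp_all add: BHNS_def TRB_def)
    have "bij_betw snd (trb_homs K (F_ob A) X) (bihom_ns_homs K A (G_ob X))"
      \<comment> \<open>The inverse pairs \<psi> with its composite with \<open>rbop X\<close>,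
        restricted so as to be extensional.\<close>
      by (rule bij_betw_byWitness[where f' = "\<lambda>\<psi>. (restrict (\<lambda>x. rbop X (\<psi> x)) (carrier A), \<psi>)"])
        (auto simp: bihom_ns_hom_lift[OF A X] dest: snd_trb_homs_F_ob)
    then show ?case
      by (simp add: BHNS_def TRB_def F_functor_def G_functor_def)
  next
    case (2 A A' X X' f h k)
    \<comment> \<open>Second components compose over the same carrier and with the same bracketing
      in both categories, so both sides unfold to the same term.\<close>
    show ?case
      by (simp add: BHNS_def TRB_def F_functor_def G_functor_def)
  qed
  then show ?thesis
    by (auto simp: left_adjoint_def)
qed

end
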